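(* Let $P\in\mathbb{Z}[x]$ be a monic polynomial. Then for all but finitely many positive integers $n$, $\delta_n(P)$ is divisible by $12$.
   Context: If $P$ has degree $d$ and roots $\alpha_1,\dots,\alpha_d$ (with multiplicity), $P_n(x):=\prod_{j=1}^d(x-\alpha_j^n)\in\mathbb{Z}[x]$ and $\Delta(P_n)=\prod_{1\le j<k\le d}(\alpha_j^n-\alpha_k^n)^2$ is its discriminant. Define $\delta_n(P):=\sum_{m\mid n}\mu(n/m)\Delta(P_m)$, with $\mu$ the Möbius function. *)

theory Defs
  imports "HOL-Computational_Algebra.Computational_Algebra"
begin

definition moebius :: "nat \<Rightarrow> int" where
  "moebius n = (if squarefree n then (- 1) ^ card (prime_factors n) else 0)"

(* proots is the multiset of roots; over the complex numbers its size is the degree. *)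
definition power_poly :: "int poly \<Rightarrow> nat \<Rightarrow> complex poly" where
  "power_poly P n = (\<Prod>\<alpha>\<in>#proots (map_poly of_int P). [:- (\<alpha> ^ n), 1:])"

definition sq_differences :: "complex list \<Rightarrow> complex" where
  "sq_differences xs = (\<Prod>k<length xs. \<Prod>j<k. (xs ! j - xs ! k)\<^sup>2)"

(* The chosen enumeration of the roots does not matter: see discriminant_eq.
   In degree 0 the exponent of the leading coefficient truncates to 0, which is
   harmless for monic polynomials. *)
definition discriminant :: "complex poly \<Rightarrow> complex" where
  "discriminant p =
     lead_coeff p ^ (2 * degree p - 2) * sq_differences (SOME xs. mset xs = proots p)"

(* An integer when P is monic, but a complex number by type, because it is computed
   from the complex roots. *)
definition delta :: "nat \<Rightarrow> int poly \<Rightarrow> complex" where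
  "delta n P = (\<Sum>m | m dvd n. of_int (moebius (n div m)) * discriminant (power_poly P m))"

lemma sq_differences_Cons:
  "sq_differences (x # xs) = (\<Prod>y\<leftarrow>xs. (x - y)\<^sup>2) * sq_differences xs"
proof -
  have "sq_differences (x # xs) =
      (\<Prod>k<length xs. (x - xs ! k)\<^sup>2 * (\<Prod>j<k. (xs ! j - xs ! k)\<^sup>2))"
    unfolding sq_differences_def
    by (simp add: prod.lessThan_Suc_shift del: prod.lessThan_Suc)
  also have "\<dots> = (\<Prod>k<length xs. (x - xs ! k)\<^sup>2) * sq_differences xs"
    by (simp add: sq_differences_def prod.distrib)
  also have "(\<Prod>k<length xs. (x - xs ! k)\<^sup>2) = (\<Prod>y\<leftarrow>xs. (x - y)\<^sup>2)"
    by (simp add: prod.list_conv_set_nth atLeast0LessThan)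
  finally show ?thesis .
qed

lemma sq_differences_middle:
  "sq_differences (xs @ y # ys) = sq_differences (y # xs @ ys)"
  by (induction xs) (simp_all add: sq_differences_Cons power2_commute mult_ac)

lemma sq_differences_mset_cong:
  "mset xs = mset ys \<Longrightarrow> sq_differences xs = sq_differences ys"
proof (induction xs arbitrary: ys)
  case Nil
  then show ?case by simp
next
  case (Cons x xs)
  have "x \<in> set ys"
    using mset_eq_setD [OF Cons.prems] by auto
  then obtain us vs where ys: "ys = us @ x # vs"
    by (meson split_list)
  have eq: "mset xs = mset (us @ vs)"
    using Cons.prems ys by simp
  have "(\<Prod>y\<leftarrow>xs. (x - y)\<^sup>2) = (\<Prod>y\<leftarrow>us @ vs. (x - y)\<^sup>2)"
    by (simp only: prod_mset_prod_list [symmetric] mset_map eq)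
  then show ?case
    using Cons.IH[OF eq] by (simp add: ys sq_differences_middle sq_differences_Cons)
qed

lemma discriminant_eq:
  assumes "mset xs = proots p"
  shows "discriminant p = lead_coeff p ^ (2 * degree p - 2) * sq_differences xs"
proof -
  have eq: "mset (SOME ys. mset ys = proots p) = mset xs"
    unfolding assms by (rule someI [of _ xs]) (rule assms)
  show ?thesis
    unfolding discriminant_def by (simp only: sq_differences_mset_cong [OF eq])
qed

lemma proots_power_poly:
  "proots (power_poly P n) = image_mset (\<lambda>\<alpha>. \<alpha> ^ n) (proots (map_poly of_int P))"
proof -
  have "proots (\<Prod>\<alpha>\<in>#A. [:- (\<alpha> ^ n), 1:]) = image_mset (\<lambda>\<alpha>. \<alpha> ^ n) A" for A :: "complex multiset"
  proof (induction A)
    case (add x A)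
    have "(\<Prod>\<alpha>\<in>#A. [:- (\<alpha> ^ n), 1:]) \<noteq> 0"
      by auto
    then show ?case
      using add by (simp add: proots_mult del: mult_pCons_left)
  qed simp
  then show ?thesis
    by (simp add: power_poly_def)
qed

lemma lead_coeff_power_poly: "lead_coeff (power_poly P n) = 1"
proof -
  have "lead_coeff (\<Prod>\<alpha>\<in>#A. [:- (\<alpha> ^ n), 1:]) = 1" for A :: "complex multiset"
    by (induction A) (simp_all add: lead_coeff_mult del: mult_pCons_left)
  then show ?thesis
    by (simp add: power_poly_def)
qed

lemma discriminant_power_poly:
  assumes "mset \<alpha> = proots (map_poly of_int P)"
  shows "discriminant (power_poly P n) =
    (\<Prod>k<length \<alpha>. \<Prod>j<k. (\<alpha> ! j ^ n - \<alpha> ! k ^ n)\<^sup>2)"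
proof -
  have "mset (map (\<lambda>x. x ^ n) \<alpha>) = proots (power_poly P n)"
    by (simp add: proots_power_poly assms)
  from discriminant_eq[OF this] show ?thesis
    by (simp add: lead_coeff_power_poly sq_differences_def)
qed

end

theory Submission
  imports Defs "Jordan_Normal_Form.Char_Poly" "HOL-Number_Theory.Cong"
begin

text \<open>
  Write \<open>V(n) = \<Prod>j<k. (\<alpha>\<^sub>k\<^sup>n - \<alpha>\<^sub>j\<^sup>n)\<close>, so that \<open>\<Delta>(n) = V(n)\<^sup>2\<close> is the discriminant of \<open>P\<^sub>n\<close>.
  Reducing \<open>x\<^bsup>nj\<^esup>\<close> modulo \<open>P\<close> shows that \<open>V(n)\<close> is an integer multiple of \<open>V(1)\<close>.
  Hence \<open>\<Delta>(n)\<close> is \<open>\<Delta>(1)\<close> times a square, and modulo 3 it is \<open>\<Delta>(1)\<close> or 0; by Stickelberger it is 0 or 1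
  modulo 4. So \<open>\<Delta>(n)\<close> modulo 12 is determined by which of 2 and 3 divide it. For \<open>p = 2, 3\<close>,
  the set of \<open>n\<close> with \<open>p | \<Delta>(n)\<close> is closed under multiples, is eventually periodic with some
  period \<open>N\<close>, and contains \<open>n\<close> whenever it contains \<open>p n\<close> (Frobenius). Together these
  make membership of \<open>n\<close> depend only on \<open>gcd n N\<close>, and the Moebius transform of a function of
  \<open>gcd n N\<close> vanishes at every \<open>n\<close> not dividing \<open>N\<close>.
\<close>

subsection \<open>Algebraic integers\<close>

text \<open>The hypotheses make \<open>z\<close> an eigenvalue of an integer matrix with eigenvector
  \<open>v\<close>, so \<open>z\<close> is a root of its characteristic polynomial, which is monic
  over the integers.\<close>

lemma algebraic_int_eigenvalue:
  fixes z :: "'a :: field_char_0" and v :: "'i \<Rightarrow> 'a" and M :: "'i \<Rightarrow> 'i \<Rightarrow> int"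
  assumes fin: "finite I" and nz: "a0 \<in> I" "v a0 \<noteq> 0"
    and eig: "\<And>a. a \<in> I \<Longrightarrow> z * v a = (\<Sum>b\<in>I. of_int (M a b) * v b)"
  shows "algebraic_int z"
proof -
  define n where "n = card I"
  obtain f where f: "bij_betw f {..<n} I"
    using ex_bij_betw_nat_finite[OF fin] by (auto simp: n_def atLeast0LessThan)
  define A :: "int mat" where "A = mat n n (\<lambda>(i,j). M (f i) (f j))"
  define B :: "'a mat" where "B = map_mat of_int A"
  define w where "w = vec n (v \<circ> f)"
  have A: "A \<in> carrier_mat n n" and B: "B \<in> carrier_mat n n" and w: "w \<in> carrier_vec n"
    by (auto simp: A_def B_def w_def)
  have "B *\<^sub>v w = z \<cdot>\<^sub>v w"
  proof (rule eq_vecI)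
    fix i assume "i < dim_vec (z \<cdot>\<^sub>v w)"
    then have i: "i < n" by (simp add: w_def)
    then have "z * v (f i) = (\<Sum>b\<in>I. of_int (M (f i) b) * v b)"
      using f by (intro eig) (auto simp: bij_betw_def)
    also have "\<dots> = (\<Sum>j<n. of_int (M (f i) (f j)) * v (f j))"
      by (rule sum.reindex_bij_betw [OF f, symmetric])
    finally show "(B *\<^sub>v w) $ i = (z \<cdot>\<^sub>v w) $ i"
      using i by (simp add: A_def B_def w_def scalar_prod_def atLeast0LessThan)
  qed (simp add: A_def B_def w_def)
  moreover have "w \<noteq> 0\<^sub>v n"
  proof
    assume w0: "w = 0\<^sub>v n"
    obtain i where "i < n" "f i = a0"
      using f nz by (auto simp: bij_betw_def image_iff)
    then have "v a0 = w $ i" by (simp add: w_def)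
    then show False using w0 nz \<open>i < n\<close> by simp
  qed
  ultimately have "eigenvalue B z"
    using B w by (auto simp: eigenvalue_def eigenvector_def)
  then have "poly (char_poly B) z = 0"
    using eigenvalue_root_char_poly[OF B] by simp
  moreover have "char_poly B = map_poly of_int (char_poly A)"
    unfolding B_def by (rule of_int_hom.char_poly_hom [OF A])
  moreover have "lead_coeff (char_poly A) = 1"
    using degree_monic_char_poly[OF A] by simp
  ultimately show ?thesis
    by (auto simp: algebraic_int_altdef_ipoly)
qed

text \<open>Pseudo-division by a monic polynomial is true division over the integers, and the
  multiple of \<open>P\<close> vanishes at each root. Positive degree of \<open>P\<close> lets a
  zero remainder satisfy the strict bound too.\<close>

lemma int_poly_mod_monic:
  fixes P Q :: "int poly"
  assumes "lead_coeff P = 1" "degree P > 0"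
  obtains R where "degree R < degree P"
    "\<And>x :: 'a :: field_char_0. poly (map_poly of_int P) x = 0 \<Longrightarrow>
       poly (map_poly of_int Q) x = poly (map_poly of_int R) x"
proof -
  obtain q R where qr: "pseudo_divmod Q P = (q, R)" by fastforce
  have "P \<noteq> 0" using assms by auto
  from pseudo_divmod[OF this qr] assms have Q: "Q = P * q + R" and R: "R = 0 \<or> degree R < degree P"
    by auto
  have "poly (map_poly of_int Q) x = poly (map_poly of_int R) x"
    if "poly (map_poly of_int P) x = 0" for x :: 'a
    using that by (simp add: Q of_int_poly_hom.hom_add of_int_poly_hom.hom_mult)
  moreover have "degree R < degree P" using R assms by auto
  ultimately show ?thesis using that by blast
qed

lemma poly_eq_sum_lessThan:
  fixes p :: "'a :: comm_semiring_1 poly"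
  assumes "degree p < n"
  shows "poly p x = (\<Sum>k<n. coeff p k * x ^ k)"
proof -
  have "poly p x = (\<Sum>k\<le>degree p. coeff p k * x ^ k)" by (rule poly_altdef)
  also have "\<dots> = (\<Sum>k<n. coeff p k * x ^ k)"
    using assms by (intro sum.mono_neutral_left) (auto simp: coeff_eq_0)
  finally show ?thesis .
qed

text \<open>The ring generated by \<open>x\<close> is a finitely generated abelian group. This
  yields closure under addition and multiplication, and later the periodicity of powers.\<close>

lemma algebraic_int_power_span:
  fixes x :: "'a :: field_char_0"
  assumes "algebraic_int x"
  obtains d and c :: "nat \<Rightarrow> nat \<Rightarrow> int"
  where "d > 0" "\<And>n. x ^ n = (\<Sum>k<d. of_int (c n k) * x ^ k)"
proof -
  from assms obtain P :: "int poly" where P: "lead_coeff P = 1" "poly (map_poly of_int P) x = 0"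
    by (auto simp: algebraic_int_altdef_ipoly)
  have d: "degree P > 0"
  proof (rule ccontr)
    assume "\<not> degree P > 0"
    then obtain a where "P = [:a:]" by (auto elim: degree_eq_zeroE)
    with P show False by simp
  qed
  have "\<exists>c. x ^ n = (\<Sum>k<degree P. of_int (c k) * x ^ k)" for n
  proof -
    obtain R where R: "degree R < degree P"
      "\<And>x :: 'a. poly (map_poly of_int P) x = 0 \<Longrightarrow>
         poly (map_poly of_int (monom 1 n)) x = poly (map_poly of_int R) x"
      using int_poly_mod_monic[OF P(1) d, where Q = "monom 1 n"] by metis
    have "x ^ n = poly (map_poly of_int R) x"
      using R(2)[OF P(2)] by (simp add: map_poly_monom poly_monom)
    also have "\<dots> = (\<Sum>k<degree P. of_int (coeff R k) * x ^ k)"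
      using R(1) by (subst poly_eq_sum_lessThan[where n = "degree P"]) (auto simp: coeff_map_poly)
    finally show ?thesis by blast
  qed
  then have "\<exists>c. \<forall>n. x ^ n = (\<Sum>k<degree P. of_int (c n k) * x ^ k)" by metis
  then show ?thesis using that d by blast
qed

text \<open>The monomials \<open>x ^ i * y ^ j\<close> with \<open>i < d\<close> and
  \<open>j < e\<close> span a group stable under multiplication by \<open>x + y\<close> and by
  \<open>x * y\<close>. They form the eigenvector, nonzero because its entry at
  \<open>(0, 0)\<close> is 1.\<close>

lemma
  fixes x y :: "'a :: field_char_0"
  assumes "algebraic_int x" "algebraic_int y"
  shows algebraic_int_add: "algebraic_int (x + y)"
    and algebraic_int_mult: "algebraic_int (x * y)"
proof -
  from algebraic_int_power_span[OF assms(1)] obtain d c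
    where d: "d > 0" and c: "\<And>n. x ^ n = (\<Sum>k<d. of_int (c n k) * x ^ k)" by blast
  from algebraic_int_power_span[OF assms(2)] obtain e b
    where e: "e > 0" and b: "\<And>n. y ^ n = (\<Sum>k<e. of_int (b n k) * y ^ k)" by blast
  let ?I = "{..<d} \<times> {..<e}" and ?v = "\<lambda>(i, j). x ^ i * y ^ j"
  have fin: "finite ?I" and zero: "(0, 0) \<in> ?I" "?v (0, 0) \<noteq> 0"
    using d e by auto
  show "algebraic_int (x + y)"
  proof (rule algebraic_int_eigenvalue[where v = ?v, OF fin zero])
    fix a assume "a \<in> ?I"
    then obtain i j where a: "a = (i, j)" "i < d" "j < e" by blast
    have "x ^ Suc i * y ^ j = (\<Sum>k<d. \<Sum>l<e. of_int (if l = j then c (Suc i) k else 0) * (x ^ k * y ^ l))"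
      using a(3) by (subst c[of "Suc i"])
        (simp add: sum_distrib_right mult.assoc if_distrib[of of_int] if_distrib[where f = "\<lambda>t. t * u" for u] if_distrib[where f = "\<lambda>t. u * t" for u] cong: if_cong)
    moreover have "x ^ i * y ^ Suc j = (\<Sum>k<d. \<Sum>l<e. of_int (if k = i then b (Suc j) l else 0) * (x ^ k * y ^ l))"
      using a(2) by (subst b[of "Suc j"], subst sum.swap)
        (simp add: sum_distrib_left mult_ac if_distrib[of of_int] if_distrib[where f = "\<lambda>t. t * u" for u] if_distrib[where f = "\<lambda>t. u * t" for u] cong: if_cong)
    ultimately show "(x + y) * ?v a = (\<Sum>a'\<in>?I. of_int ((\<lambda>(i, j) (k, l).
        (if l = j then c (Suc i) k else 0) + (if k = i then b (Suc j) l else 0)) a a') * ?v a')"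
      unfolding a sum.cartesian_product[symmetric]
      by (simp add: sum.cartesian_product' sum.distrib algebra_simps)
  qed
  show "algebraic_int (x * y)"
  proof (rule algebraic_int_eigenvalue[where v = ?v, OF fin zero])
    fix a assume "a \<in> ?I"
    then obtain i j where a: "a = (i, j)" "i < d" "j < e" by blast
    have "x ^ Suc i * y ^ Suc j =
        (\<Sum>k<d. \<Sum>l<e. of_int (c (Suc i) k * b (Suc j) l) * (x ^ k * y ^ l))"
      by (subst c[of "Suc i"], subst b[of "Suc j"]) (simp add: sum_product mult_ac)
    then show "x * y * ?v a = (\<Sum>a'\<in>?I. of_int ((\<lambda>(i, j) (k, l).
        c (Suc i) k * b (Suc j) l) a a') * ?v a')"
      unfolding a by (simp add: sum.cartesian_product' mult_ac)
  qed
qed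

lemma algebraic_int_diff:
  fixes x y :: "'a :: field_char_0"
  shows "algebraic_int x \<Longrightarrow> algebraic_int y \<Longrightarrow> algebraic_int (x - y)"
  using algebraic_int_add[of x "- y"] by auto

lemma algebraic_int_of_int: "algebraic_int (of_int k :: 'a :: field_char_0)"
  by (rule int_imp_algebraic_int) simp

lemma algebraic_int_1: "algebraic_int (1 :: 'a :: field_char_0)"
  using algebraic_int_of_int[of 1] by simp

lemma algebraic_int_power:
  fixes x :: "'a :: field_char_0"
  shows "algebraic_int x \<Longrightarrow> algebraic_int (x ^ n)"
  by (induction n) (auto intro: algebraic_int_mult algebraic_int_1)

lemma algebraic_int_sum:
  fixes f :: "'b \<Rightarrow> 'a :: field_char_0"
  shows "(\<And>i. i \<in> I \<Longrightarrow> algebraic_int (f i)) \<Longrightarrow> algebraic_int (sum f I)"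
  by (induction I rule: infinite_finite_induct) (auto intro: algebraic_int_add)

lemma algebraic_int_prod:
  fixes f :: "'b \<Rightarrow> 'a :: field_char_0"
  shows "(\<And>i. i \<in> I \<Longrightarrow> algebraic_int (f i)) \<Longrightarrow> algebraic_int (prod f I)"
  by (induction I rule: infinite_finite_induct) (auto intro: algebraic_int_mult algebraic_int_1)

subsection \<open>Vandermonde determinants at the roots of a monic polynomial\<close>

definition vandermonde :: "nat \<Rightarrow> (nat \<Rightarrow> 'a :: comm_ring_1) \<Rightarrow> 'a" where
  "vandermonde d x = (\<Prod>k<d. \<Prod>j<k. x k - x j)"

text \<open>The matrix of values is the matrix of powers times the matrix of coefficients.\<close>

lemma det_poly_values:
  fixes x :: "nat \<Rightarrow> 'a :: comm_ring_1"
  assumes "\<And>j. j < d \<Longrightarrow> degree (g j) < d"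
  shows "det (mat d d (\<lambda>(i, j). poly (g j) (x i))) =
    det (mat d d (\<lambda>(i, j). x i ^ j)) * det (mat d d (\<lambda>(k, j). coeff (g j) k))"
proof -
  have "mat d d (\<lambda>(i, j). poly (g j) (x i)) =
      mat d d (\<lambda>(i, j). x i ^ j) * mat d d (\<lambda>(k, j). coeff (g j) k)"
    using assms
    by (intro eq_matI)
      (auto simp: scalar_prod_def poly_eq_sum_lessThan[where n = d] atLeast0LessThan mult.commute)
  then show ?thesis
    by (simp add: det_mult[where n = d])
qed

text \<open>Evaluating the Newton basis \<open>\<Prod>l<j. (X - x l)\<close> instead of the monomials makes the
  matrix triangular, and the change of basis is unitriangular.\<close>

lemma det_vandermonde:
  fixes x :: "nat \<Rightarrow> 'a :: idom"
  shows "det (mat d d (\<lambda>(i, j). x i ^ j)) = vandermonde d x"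
proof -
  define g where "g j = (\<Prod>l<j. [:- x l, 1:])" for j
  have monic: "degree (g j) = j \<and> lead_coeff (g j) = 1" for j
  proof (induction j)
    case (Suc j)
    have "g (Suc j) = g j * [:- x j, 1:]" by (simp add: g_def)
    moreover have "g j \<noteq> 0" using Suc by auto
    then have "degree (g j * [:- x j, 1:]) = degree (g j) + degree [:- x j, 1:]"
      by (intro degree_mult_eq) auto
    moreover have "lead_coeff (g j * [:- x j, 1:]) = lead_coeff (g j) * lead_coeff [:- x j, 1:]"
      by (rule lead_coeff_mult)
    ultimately show ?case
      using Suc[THEN conjunct1] Suc[THEN conjunct2] by (simp del: mult_pCons_right)
  qed (simp add: g_def)
  have lower: "det (mat d d (\<lambda>(i, j). poly (g j) (x i))) = vandermonde d x"
  proof (subst det_lower_triangular[of d])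
    show "mat d d (\<lambda>(i, j). poly (g j) (x i)) $$ (i, j) = 0" if "i < j" "j < d" for i j
      using that by (auto simp: g_def poly_prod)
    show "prod_list (diag_mat (mat d d (\<lambda>(i, j). poly (g j) (x i)))) = vandermonde d x"
      by (simp add: prod_list_diag_prod g_def poly_prod vandermonde_def atLeast0LessThan)
  qed simp
  have upper: "det (mat d d (\<lambda>(k, j). coeff (g j) k)) = 1"
  proof (subst det_upper_triangular[of _ d])
    show "upper_triangular (mat d d (\<lambda>(k, j). coeff (g j) k))"
      using monic by (auto intro!: upper_triangularI coeff_eq_0)
    show "prod_list (diag_mat (mat d d (\<lambda>(k, j). coeff (g j) k))) = 1"
      using monic by (auto simp: prod_list_diag_prod intro!: prod.neutral) metis
  qed simp
  show ?thesis
    using det_poly_values[of d g x] monic by (simp add: lower upper)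
qed

lemma det_scale_rows:
  fixes f :: "nat \<Rightarrow> 'a :: idom"
  shows "det (mat d d (\<lambda>(i, j). f i * b i j)) = (\<Prod>i<d. f i) * det (mat d d (\<lambda>(i, j). b i j))"
proof -
  let ?D = "mat d d (\<lambda>(i, j). if i = j then f i else 0)"
  have "mat d d (\<lambda>(i, j). f i * b i j) = ?D * mat d d (\<lambda>(i, j). b i j)"
    by (intro eq_matI)
      (auto simp: scalar_prod_def if_distrib[where f = "\<lambda>t. t * u" for u] cong: if_cong)
  moreover have "det ?D = (\<Prod>i<d. f i)"
    by (subst det_upper_triangular[of _ d])
      (auto intro!: upper_triangularI simp: prod_list_diag_prod atLeast0LessThan)
  ultimately show ?thesis
    by (simp add: det_mult[where n = d])
qed

text \<open>Each unordered pair of indices contributes two factors of opposite sign. The sign stays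
  unspecified because only integrality is drawn from this identity.\<close>

lemma prod_differences_eq_vandermonde:
  fixes x :: "nat \<Rightarrow> 'a :: comm_ring_1"
  shows "\<exists>e. (\<Prod>i<d. \<Prod>j\<in>{..<d} - {i}. x i - x j) = (- 1) ^ e * (vandermonde d x)\<^sup>2"
proof (induction d)
  case (Suc d)
  then obtain e where e: "(\<Prod>i<d. \<Prod>j\<in>{..<d} - {i}. x i - x j) = (- 1) ^ e * (vandermonde d x)\<^sup>2"
    by blast
  have "(\<Prod>j\<in>{..<Suc d} - {i}. x i - x j) = (- 1) * (x d - x i) * (\<Prod>j\<in>{..<d} - {i}. x i - x j)"
    if "i < d" for i
  proof -
    have "{..<Suc d} - {i} = insert d ({..<d} - {i})" using that by auto
    then show ?thesis by simp
  qed
  moreover have "{..<Suc d} - {d} = {..<d}" by auto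
  moreover have "(\<Prod>i<n. - (x d - x i)) = (- 1) ^ n * (\<Prod>i<n. x d - x i)" for n
    by (induction n) (simp_all add: algebra_simps)
  ultimately have "(\<Prod>i<Suc d. \<Prod>j\<in>{..<Suc d} - {i}. x i - x j) =
      (- 1) ^ d * (\<Prod>i<d. x d - x i) * ((- 1) ^ e * (vandermonde d x)\<^sup>2) * (\<Prod>j<d. x d - x j)"
    by (simp add: prod.distrib e[symmetric])
  also have "\<dots> = (- 1) ^ (d + e) * (vandermonde (Suc d) x)\<^sup>2"
    by (simp add: vandermonde_def power2_eq_square power_add)
  finally show ?case by blast
qed (simp add: vandermonde_def exI[of _ 0])

section \<open>Integrality at the roots of a fixed monic integer polynomial\<close>

locale monic_roots =
  fixes P :: "int poly" and d :: nat and \<alpha> :: "nat \<Rightarrow> complex"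
  assumes monic: "lead_coeff P = 1"
    and factors: "map_poly of_int P = (\<Prod>i<d. [:- \<alpha> i, 1:])"
begin

lemma degree_P: "degree P = d"
proof -
  have "degree (\<Prod>i<d. [:- \<alpha> i, 1:]) = (\<Sum>i<d. degree [:- \<alpha> i, 1:])"
    by (rule degree_prod_eq_sum_degree) auto
  then show ?thesis
    by (simp flip: factors)
qed

lemma root: "i < d \<Longrightarrow> poly (map_poly of_int P) (\<alpha> i) = 0"
  by (auto simp: factors poly_prod)

lemma algebraic_int_root: "i < d \<Longrightarrow> algebraic_int (\<alpha> i)"
  using root monic by (auto simp: algebraic_int_altdef_ipoly)

text \<open>Reducing each \<open>Q j\<close> modulo \<open>P\<close> keeps its values at the roots;
  \<open>s\<close> is then the determinant of the integer coefficient matrix of the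
  remainders.\<close>

lemma det_int_poly_values:
  fixes Q :: "nat \<Rightarrow> int poly"
  shows "\<exists>s. det (mat d d (\<lambda>(i, j). poly (map_poly of_int (Q j)) (\<alpha> i))) =
    vandermonde d \<alpha> * of_int s"
\<comment> \<open>No remainder has degree below 0, so the empty determinant is treated
  separately.\<close>
proof (cases "d = 0")
  case True
  have "det (mat 0 0 f) = 1" for f :: "nat \<times> nat \<Rightarrow> complex"
    by (rule det_dim_zero) simp
  then show ?thesis using True by (auto simp: vandermonde_def intro: exI[of _ 1])
next
  case False
  have "\<exists>R. degree R < d \<and>
      (\<forall>i<d. poly (map_poly of_int (Q j)) (\<alpha> i) = poly (map_poly of_int R) (\<alpha> i))" for j
    using int_poly_mod_monic[OF monic, where Q = "Q j" and 'a = complex] False root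
    unfolding degree_P by (metis neq0_conv)
  then obtain R where R: "\<And>j. degree (R j) < d"
      "\<And>i j. i < d \<Longrightarrow> poly (map_poly of_int (Q j)) (\<alpha> i) = poly (map_poly of_int (R j)) (\<alpha> i)"
    by metis
  let ?A = "mat d d (\<lambda>(k, j). coeff (R j) k)"
  have "det (mat d d (\<lambda>(i, j). poly (map_poly of_int (Q j)) (\<alpha> i))) =
      det (mat d d (\<lambda>(i, j). poly (map_poly of_int (R j)) (\<alpha> i)))"
    by (intro arg_cong[where f = det] eq_matI) (auto simp: R(2))
  also have "\<dots> = vandermonde d \<alpha> * det (mat d d (\<lambda>(k, j). coeff (map_poly of_int (R j)) k))"
    using R(1) by (simp add: det_poly_values det_vandermonde)
  also have "mat d d (\<lambda>(k, j). coeff (map_poly of_int (R j)) k) = map_mat of_int ?A"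
    by (intro eq_matI) auto
  finally show ?thesis by (auto simp: of_int_hom.hom_det)
qed

lemma vandermonde_power_multiple:
  "\<exists>s. vandermonde d (\<lambda>i. \<alpha> i ^ n) = vandermonde d \<alpha> * of_int s"
  using det_int_poly_values[of "\<lambda>j. monom 1 (n * j)"]
  by (simp add: map_poly_monom poly_monom power_mult det_vandermonde)

text \<open>The product is the resultant of \<open>P\<close> and \<open>Q\<close>. Replacing
  \<open>x ^ j\<close> by \<open>Q * x ^ j\<close> scales row \<open>i\<close> by the value of
  \<open>Q\<close> at \<open>\<alpha> i\<close>, so product times Vandermonde is an integer times
  Vandermonde, and the latter cancels.\<close>

lemma prod_int_poly_roots:
  assumes "vandermonde d \<alpha> \<noteq> 0"
  shows "(\<Prod>i<d. poly (map_poly of_int Q) (\<alpha> i)) \<in> \<int>"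
proof -
  obtain s :: int where
    "det (mat d d (\<lambda>(i, j). poly (map_poly of_int (Q * monom 1 j)) (\<alpha> i))) = vandermonde d \<alpha> * of_int s"
    using det_int_poly_values[of "\<lambda>j. Q * monom 1 j"] by blast
  then have "(\<Prod>i<d. poly (map_poly of_int Q) (\<alpha> i)) * vandermonde d \<alpha> = vandermonde d \<alpha> * of_int s"
    by (simp add: of_int_poly_hom.hom_mult map_poly_monom poly_monom det_scale_rows det_vandermonde)
  with assms show ?thesis by simp
qed

text \<open>Up to sign, the square is the product of the values of the derivative of
  \<open>P\<close> at the roots.\<close>

lemma vandermonde_square_int: "(vandermonde d \<alpha>)\<^sup>2 \<in> \<int>"
proof (cases "vandermonde d \<alpha> = 0")
  case False
  have deriv: "poly (map_poly of_int (pderiv P)) (\<alpha> i) = (\<Prod>j\<in>{..<d} - {i}. \<alpha> i - \<alpha> j)"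
    if i: "i < d" for i
  proof -
    have "poly (map_poly of_int (pderiv P)) (\<alpha> i) = poly (pderiv (map_poly of_int P)) (\<alpha> i)"
      by (simp add: of_int_hom.map_poly_pderiv)
    also have "\<dots> = (\<Sum>k<d. \<Prod>j\<in>{..<d} - {k}. \<alpha> i - \<alpha> j)"
      by (simp add: factors pderiv_prod poly_sum poly_prod pderiv_pCons)
    \<comment> \<open>For \<open>k\<close> other than \<open>i\<close>, the product contains the
      zero factor with \<open>j = i\<close>.\<close>
    also have "\<dots> = (\<Sum>k\<in>{i}. \<Prod>j\<in>{..<d} - {k}. \<alpha> i - \<alpha> j)"
      using i by (intro sum.mono_neutral_right) auto
    finally show ?thesis by simp
  qed
  obtain e where "(\<Prod>i<d. \<Prod>j\<in>{..<d} - {i}. \<alpha> i - \<alpha> j) = (- 1) ^ e * (vandermonde d \<alpha>)\<^sup>2"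
    using prod_differences_eq_vandermonde by blast
  with prod_int_poly_roots[OF False, of "pderiv P"]
  have "(- 1) ^ e * (vandermonde d \<alpha>)\<^sup>2 \<in> \<int>"
    by (simp add: deriv)
  then show ?thesis
    by (cases "even e") simp_all
qed simp

end

subsection \<open>Congruences between algebraic integers\<close>

definition alg_cong :: "int \<Rightarrow> 'a :: field_char_0 \<Rightarrow> 'a \<Rightarrow> bool" where
  "alg_cong m x y \<longleftrightarrow> (\<exists>z. algebraic_int z \<and> x = y + of_int m * z)"

lemma alg_cong_refl: "alg_cong m x x"
  by (auto simp: alg_cong_def intro: exI[of _ 0])

lemma alg_cong_trans: "alg_cong m x y \<Longrightarrow> alg_cong m y z \<Longrightarrow> alg_cong m x z"
  unfolding alg_cong_def
proof (elim exE conjE)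
  fix u v assume "algebraic_int u" "x = y + of_int m * u" "algebraic_int v" "y = z + of_int m * v"
  then show "\<exists>w. algebraic_int w \<and> x = z + of_int m * w"
    by (intro exI[of _ "u + v"]) (auto simp: algebra_simps intro: algebraic_int_add)
qed

lemma alg_cong_diff:
  assumes "alg_cong m x y" "alg_cong m x' y'"
  shows "alg_cong m (x - x') (y - y')"
proof -
  from assms obtain z z' where "algebraic_int z" "x = y + of_int m * z"
    "algebraic_int z'" "x' = y' + of_int m * z'" by (auto simp: alg_cong_def)
  then show ?thesis unfolding alg_cong_def
    by (intro exI[of _ "z - z'"]) (auto simp: algebra_simps intro: algebraic_int_diff)
qed

lemma alg_cong_mult:
  assumes "alg_cong m x y" "alg_cong m x' y'" "algebraic_int y" "algebraic_int y'"
  shows "alg_cong m (x * x') (y * y')"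
proof -
  from assms obtain z z' where "algebraic_int z" "x = y + of_int m * z"
    "algebraic_int z'" "x' = y' + of_int m * z'" by (auto simp: alg_cong_def)
  then show ?thesis unfolding alg_cong_def using assms(3,4)
    by (intro exI[of _ "z * y' + y * z' + of_int m * z * z'"])
      (auto simp: algebra_simps intro!: algebraic_int_add algebraic_int_mult algebraic_int_of_int)
qed

lemma alg_cong_prod:
  assumes "\<And>i. i \<in> I \<Longrightarrow> alg_cong m (f i) (g i)" "\<And>i. i \<in> I \<Longrightarrow> algebraic_int (g i)"
  shows "alg_cong m (prod f I) (prod g I)"
  using assms
  by (induction I rule: infinite_finite_induct)
    (auto intro!: alg_cong_mult alg_cong_refl algebraic_int_prod)

lemma alg_cong_power:
  "alg_cong m x y \<Longrightarrow> algebraic_int y \<Longrightarrow> alg_cong m (x ^ n) (y ^ n)"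
  by (induction n) (auto intro!: alg_cong_mult alg_cong_refl algebraic_int_power)

text \<open>For nonzero \<open>m\<close> the quotient \<open>(a - b) / m\<close> is rational and an
  algebraic integer, hence an integer.\<close>

lemma alg_cong_imp_cong:
  assumes "alg_cong m (of_int a :: 'a :: field_char_0) (of_int b)"
  shows "[a = b] (mod m)"
proof (cases "m = 0")
  case False
  from assms obtain z :: 'a where z: "algebraic_int z" "of_int a = of_int b + of_int m * z"
    by (auto simp: alg_cong_def)
  then have "z = of_int (a - b) / of_int m" using False by (simp add: field_simps)
  then have "z \<in> \<rat>" by simp
  with z(1) have "z \<in> \<int>" by (rule rational_algebraic_int_is_int)
  then obtain t where "z = of_int t" by (auto elim: Ints_cases)
  with z(2) have "a = b + m * t"
    by (metis of_int_add of_int_eq_iff of_int_mult)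
  then show ?thesis by (auto simp: cong_def)
qed (use assms in \<open>auto simp: alg_cong_def\<close>)

lemma alg_cong_frobenius:
  assumes p: "p = 2 \<or> p = 3" and x: "algebraic_int x" and y: "algebraic_int y"
  shows "alg_cong (int p) (x ^ p - y ^ p) ((x - y) ^ p)"
  using p
proof
  assume "p = 2"
  then show ?thesis using x y unfolding alg_cong_def
    by (intro exI[of _ "x * y - y * y"])
      (auto simp: power2_eq_square algebra_simps intro!: algebraic_int_diff algebraic_int_mult)
next
  assume "p = 3"
  then show ?thesis using x y unfolding alg_cong_def
    by (intro exI[of _ "x * x * y - x * y * y"])
      (auto simp: power3_eq_cube algebra_simps intro!: algebraic_int_diff algebraic_int_mult)
qed

text \<open>By pigeonhole, two powers \<open>x ^ a\<close> and \<open>x ^ b\<close> have the same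
  coefficient vector modulo \<open>m\<close>; multiplying by \<open>x ^ (n - a)\<close> propagates
  their congruence to every \<open>n \<ge> a\<close>.\<close>

lemma algebraic_int_power_periodic:
  fixes x :: "'a :: field_char_0"
  assumes x: "algebraic_int x" and m: "m > 0"
  shows "\<exists>N>0. \<exists>n0. \<forall>n\<ge>n0. alg_cong m (x ^ (n + N)) (x ^ n)"
proof -
  from algebraic_int_power_span[OF x] obtain d c
    where c: "\<And>n. x ^ n = (\<Sum>k<d. of_int (c n k) * x ^ k)" by metis
  \<comment> \<open>Restricting to \<open>{..<d}\<close> places the residue vectors in a finite
    function space.\<close>
  define r where "r n = restrict (\<lambda>k. c n k mod m) {..<d}" for n
  have "range r \<subseteq> PiE {..<d} (\<lambda>_. {0..<m})"
    using m by (auto simp: r_def PiE_iff split: if_splits)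
  then have "finite (range r)"
    by (rule finite_subset) (simp add: finite_PiE)
  then have "\<not> inj r"
    using finite_imageD by blast
  then obtain a b where ab: "r a = r b" "a < b"
    by (metis injI linorder_neqE_nat)
  have "alg_cong m (x ^ b) (x ^ a)"
    unfolding alg_cong_def
  proof (intro exI conjI)
    show "algebraic_int (\<Sum>k<d. of_int ((c b k - c a k) div m) * x ^ k)"
      using x by (intro algebraic_int_sum algebraic_int_mult algebraic_int_of_int algebraic_int_power)
    have "c b k = c a k + m * ((c b k - c a k) div m)" if "k < d" for k
      using fun_cong[OF ab(1), of k] that
      by (simp add: r_def mod_eq_dvd_iff[symmetric])
    then have "x ^ b = (\<Sum>k<d. of_int (c a k + m * ((c b k - c a k) div m)) * x ^ k)"
      by (subst c) simp
    also have "\<dots> = x ^ a + of_int m * (\<Sum>k<d. of_int ((c b k - c a k) div m) * x ^ k)"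
      by (subst (2) c) (simp add: algebra_simps sum.distrib sum_distrib_left)
    finally show "x ^ b = x ^ a + of_int m * (\<Sum>k<d. of_int ((c b k - c a k) div m) * x ^ k)" .
  qed
  then have "alg_cong m (x ^ b * x ^ (n - a)) (x ^ a * x ^ (n - a))" if "n \<ge> a" for n
    using x by (intro alg_cong_mult alg_cong_refl algebraic_int_power)
  then have "alg_cong m (x ^ (n + (b - a))) (x ^ n)" if "n \<ge> a" for n
  proof -
    have "b + (n - a) = n + (b - a)" "a + (n - a) = n" using that ab(2) by simp_all
    with that show ?thesis
      using \<open>\<And>n. n \<ge> a \<Longrightarrow> alg_cong m (x ^ b * x ^ (n - a)) (x ^ a * x ^ (n - a))\<close>
      by (metis power_add)
  qed
  with ab(2) show ?thesis
    by (intro exI[of _ "b - a"]) auto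
qed

lemma alg_cong_power_iterate_period:
  assumes "\<And>n. n \<ge> n0 \<Longrightarrow> alg_cong m (x ^ (n + N)) (x ^ n)" "n \<ge> n0"
  shows "alg_cong m (x ^ (n + N * k)) (x ^ n)"
proof (induction k)
  case (Suc k)
  have "alg_cong m (x ^ (n + N * k + N)) (x ^ (n + N * k))"
    using assms by simp
  with Suc show ?case
    by (auto simp: algebra_simps intro: alg_cong_trans)
qed (simp add: alg_cong_refl)

lemma algebraic_int_powers_periodic:
  fixes x :: "'i \<Rightarrow> 'a :: field_char_0"
  assumes "finite I" "\<And>i. i \<in> I \<Longrightarrow> algebraic_int (x i)" and m: "m > 0"
  shows "\<exists>N>0. \<exists>n0. \<forall>i\<in>I. \<forall>n\<ge>n0. alg_cong m (x i ^ (n + N)) (x i ^ n)"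
  using assms(1,2)
proof (induction I rule: finite_induct)
  case (insert a I)
  then obtain N n0 where N: "N > 0" "\<And>i n. i \<in> I \<Longrightarrow> n \<ge> n0 \<Longrightarrow> alg_cong m (x i ^ (n + N)) (x i ^ n)"
    by (metis insertCI)
  from insert algebraic_int_power_periodic[OF _ m] obtain N' n0'
    where N': "N' > 0" "\<And>n. n \<ge> n0' \<Longrightarrow> alg_cong m (x a ^ (n + N')) (x a ^ n)"
    by (metis insertCI)
  \<comment> \<open>The product of the two periods is a common period, valid from the larger
    threshold on.\<close>
  have "alg_cong m (x i ^ (n + N * N')) (x i ^ n)"
      if i: "i \<in> insert a I" and n: "max n0 n0' \<le> n" for i n
    proof (cases "i = a")
      case True
      then show ?thesis
        using alg_cong_power_iterate_period[of n0' m "x a" N' n N, OF N'(2)] n by (simp add: mult.commute)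
    next
      case False
      then show ?thesis
        using alg_cong_power_iterate_period[of n0 m "x i" N n N', OF N(2)] i n by simp
    qed
  moreover have "N * N' > 0" using N(1) N'(1) by simp
  ultimately show ?case by blast
qed auto

subsection \<open>Moebius transforms of functions of a gcd\<close>

text \<open>The power of \<open>p\<close> in the gcd is already capped by \<open>N\<close>, and the
  extra factor \<open>p\<close> affects no other prime.\<close>

lemma gcd_mult_prime_eq:
  fixes p h N :: nat
  assumes p: "prime p" and le: "multiplicity p N \<le> multiplicity p h" and pos: "h > 0" "N > 0"
  shows "gcd (p * h) N = gcd h N"
proof (rule dvd_antisym)
  let ?x = "gcd (p * h) N"
  have "?x dvd h"
  proof (rule multiplicity_le_imp_dvd)
    fix r :: nat assume r: "prime r"
    show "multiplicity r ?x \<le> multiplicity r h"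
    proof (cases "r = p")
      case True
      have "multiplicity p ?x \<le> multiplicity p N"
        using pos by (intro dvd_imp_multiplicity_le) auto
      then show ?thesis using le True by simp
    next
      case False
      have "multiplicity r ?x \<le> multiplicity r (p * h)"
        using pos p by (intro dvd_imp_multiplicity_le) (auto simp: prime_gt_0_nat)
      also have "\<dots> = multiplicity r h"
        using r p pos False
        by (subst prime_elem_multiplicity_mult_distrib)
          (auto simp: prime_multiplicity_other prime_gt_0_nat)
      finally show ?thesis .
    qed
  qed (use pos in simp)
  then show "?x dvd gcd h N" by simp
qed simp

lemma moebius_mult_prime:
  assumes p: "prime p" and e: "squarefree e" "\<not> p dvd e"
  shows "moebius (p * e) = - moebius e"
proof -
  have e0: "e \<noteq> 0" using e(2) by (metis dvd_0_right)
  have "coprime p e" using p e by (simp add: prime_imp_coprime)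
  then have "squarefree (p * e)"
    using e p by (simp add: squarefree_mult_coprime squarefree_prime)
  moreover have "prime_factors (p * e) = insert p (prime_factors e)"
    using p e0 by (subst prime_factors_product) (auto simp: prime_prime_factors)
  moreover have "p \<notin> prime_factors e" using e(2) by auto
  ultimately show ?thesis using e(1) by (simp add: moebius_def)
qed

text \<open>A prime \<open>p\<close> with higher multiplicity in \<open>n\<close> than in \<open>N\<close> pairs the terms of \<open>e\<close> and \<open>p e\<close>:
  their signs are opposite and \<open>n/e\<close>, \<open>n/(p e)\<close> have the same gcd with \<open>N\<close>.\<close>

lemma dvd_moebius_sum_gcd:
  fixes f :: "nat \<Rightarrow> int"
  assumes f: "\<And>m. m > 0 \<Longrightarrow> [f m = f (gcd m N)] (mod q)"
    and n: "n > 0" "\<not> n dvd N" and N: "N > 0"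
  shows "q dvd (\<Sum>m | m dvd n. moebius (n div m) * f m)"
proof -
  obtain p where p: "prime p" "multiplicity p N < multiplicity p n"
    using n multiplicity_le_imp_dvd[of n N] by (metis not_less neq0_conv)
  have pn: "p dvd n"
    using p(2) by (metis not_dvd_imp_multiplicity_0 not_less0)
  \<comment> \<open>After substituting \<open>e = n div m\<close>, only squarefree \<open>e\<close>
    contribute. They split into \<open>A\<close>, those prime to \<open>p\<close>, and the multiples
    by \<open>p\<close> of elements of \<open>A\<close>.\<close>
  define S where "S = {e. e dvd n \<and> squarefree e}"
  define A where "A = {e \<in> S. \<not> p dvd e}"
  have fin: "finite {e. e dvd n}" using n by simp
  have finS: "finite S" and finA: "finite A"
    using fin by (auto simp: S_def A_def)
  have S: "S = A \<union> (*) p ` A"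
  proof (intro equalityI subsetI)
    fix e assume e: "e \<in> S"
    show "e \<in> A \<union> (*) p ` A"
    proof (cases "p dvd e")
      case True
      then obtain e' where e': "e = p * e'" by blast
      have "\<not> p dvd e'"
      proof
        assume "p dvd e'"
        then have "p ^ 2 dvd e" by (simp add: e' power2_eq_square)
        with e have "p dvd 1" by (auto simp: S_def squarefree_def)
        with p show False by simp
      qed
      moreover have "e' dvd e" by (simp add: e')
      ultimately have "e' \<in> A"
        using e by (auto simp: A_def S_def intro: squarefree_mono dvd_trans)
      then show ?thesis unfolding e' by blast
    qed (use e in \<open>simp add: A_def\<close>)
  next
    fix e assume "e \<in> A \<union> (*) p ` A"
    moreover have "p * e \<in> S" if "e \<in> A" for e
    proof -
      have "coprime p e" using that p by (simp add: A_def prime_imp_coprime)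
      then show ?thesis
        using that pn p
        by (auto simp: A_def S_def divides_mult squarefree_mult_coprime squarefree_prime)
    qed
    ultimately show "e \<in> S" by (auto simp: A_def)
  qed
  have p0: "p > 0" using p by (simp add: prime_gt_0_nat)
  have "(\<Sum>m | m dvd n. moebius (n div m) * f m) = (\<Sum>e | e dvd n. moebius e * f (n div e))"
    using n by (intro sum.reindex_bij_witness[of _ "\<lambda>e. n div e" "\<lambda>e. n div e"])
      (auto simp: div_dvd_iff_mult elim!: dvdE)
  also have "\<dots> = (\<Sum>e\<in>S. moebius e * f (n div e))"
    using fin by (intro sum.mono_neutral_right) (auto simp: S_def moebius_def)
  also have "\<dots> = (\<Sum>e\<in>A. moebius e * f (n div e)) + (\<Sum>e\<in>(*) p ` A. moebius e * f (n div e))"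
    unfolding S by (rule sum.union_disjoint) (use finA in \<open>auto simp: A_def\<close>)
  also have "(\<Sum>e\<in>(*) p ` A. moebius e * f (n div e)) = (\<Sum>e\<in>A. - moebius e * f (n div (p * e)))"
    using p0 p(1) by (subst sum.reindex) (auto simp: inj_on_def A_def S_def moebius_mult_prime intro!: sum.cong)
  also have "(\<Sum>e\<in>A. moebius e * f (n div e)) + \<dots> =
      (\<Sum>e\<in>A. moebius e * (f (n div e) - f (n div (p * e))))"
    by (simp add: sum.distrib[symmetric] algebra_simps)
  also have "q dvd \<dots>"
  proof (rule dvd_sum, rule dvd_mult)
    fix e assume e: "e \<in> A"
    then have "p * e \<in> S" using S by blast
    then obtain h where h: "n = p * e * h" by (auto simp: S_def)
    have pos: "h > 0" "e > 0" using n h by auto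
    \<comment> \<open>As \<open>p\<close> does not divide \<open>e\<close>, passing from
      \<open>n\<close> to \<open>h\<close> loses one factor \<open>p\<close>, so \<open>h\<close>
      still has at least as many as \<open>N\<close>.\<close>
    have "multiplicity p n = Suc (multiplicity p h)"
      using p(1) pos e unfolding h
      by (simp add: prime_elem_multiplicity_mult_distrib not_dvd_imp_multiplicity_0 A_def)
    then have "gcd (p * h) N = gcd h N"
      using p pos N by (intro gcd_mult_prime_eq) auto
    moreover have "n div e = p * h" "n div (p * e) = h"
      using h pos p0 by auto
    ultimately have "[f (n div e) = f (n div (p * e))] (mod q)"
      using f[of h] f[of "p * h"] pos p0 by (metis cong_sym cong_trans nat_0_less_mult_iff)
    then show "q dvd f (n div e) - f (n div (p * e))"
      by (simp add: cong_iff_dvd_diff)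
  qed
  finally show ?thesis .
qed

subsection \<open>Discriminants modulo 12\<close>

context monic_roots
begin

text \<open>Floor and real part only turn the complex value into an \<open>int\<close>;
  \<open>of_int_D\<close> shows that nothing is lost.\<close>

definition Delta :: "nat \<Rightarrow> int" where
  "Delta n = \<lfloor>Re ((vandermonde d (\<lambda>i. \<alpha> i ^ n))\<^sup>2)\<rfloor>"

lemma of_int_D: "of_int (Delta n) = (vandermonde d (\<lambda>i. \<alpha> i ^ n))\<^sup>2"
proof -
  obtain s where "vandermonde d (\<lambda>i. \<alpha> i ^ n) = vandermonde d \<alpha> * of_int s"
    using vandermonde_power_multiple by blast
  then have "(vandermonde d (\<lambda>i. \<alpha> i ^ n))\<^sup>2 \<in> \<int>"
    using vandermonde_square_int by (simp add: power_mult_distrib)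
  then obtain k where "(vandermonde d (\<lambda>i. \<alpha> i ^ n))\<^sup>2 = of_int k"
    by (auto elim: Ints_cases)
  then show ?thesis by (simp add: Delta_def)
qed

lemma Delta_eq_square_mult: "\<exists>s. Delta n = Delta 1 * s\<^sup>2"
proof -
  obtain s where "vandermonde d (\<lambda>i. \<alpha> i ^ n) = vandermonde d \<alpha> * of_int s"
    using vandermonde_power_multiple by blast
  then have "(of_int (Delta n) :: complex) = of_int (Delta 1 * s\<^sup>2)"
    by (simp add: of_int_D power_mult_distrib)
  then show ?thesis unfolding of_int_eq_iff by blast
qed

text \<open>The difference of two \<open>m\<close>-th powers divides that of the
  \<open>m * k\<close>-th powers, with a geometric sum as quotient. The product \<open>q\<close> of
  these quotients is an algebraic integer, which suffices for a congruence.\<close>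

lemma dvd_D_mult:
  assumes "p dvd Delta m"
  shows "p dvd Delta (m * k)"
proof -
  define q where "q = (\<Prod>a<d. \<Prod>b<a. \<Sum>i<k. (\<alpha> b ^ m) ^ (k - Suc i) * (\<alpha> a ^ m) ^ i)"
  have q: "algebraic_int q"
    unfolding q_def using algebraic_int_root
    by (intro algebraic_int_prod algebraic_int_sum algebraic_int_mult algebraic_int_power) auto
  have "vandermonde d (\<lambda>i. \<alpha> i ^ (m * k)) = vandermonde d (\<lambda>i. \<alpha> i ^ m) * q"
    unfolding vandermonde_def q_def
    by (simp add: power_mult power_diff_sumr2 prod.distrib)
  then have eq: "(of_int (Delta (m * k)) :: complex) = of_int (Delta m) * q\<^sup>2"
    by (simp add: of_int_D power_mult_distrib)
  from assms obtain t where t: "Delta m = p * t" by blast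
  have "alg_cong p (of_int (Delta (m * k)) :: complex) (of_int 0)"
    unfolding alg_cong_def using q
    by (intro exI[of _ "of_int t * q\<^sup>2"])
      (auto simp: eq t intro!: algebraic_int_mult algebraic_int_power algebraic_int_of_int)
  from alg_cong_imp_cong[OF this] show ?thesis
    by (simp add: cong_0_iff)
qed

lemma alg_cong_vandermonde_square:
  assumes "\<And>a b. b < a \<Longrightarrow> a < d \<Longrightarrow> alg_cong m (x a - x b) (y a - y b)"
    and "\<And>a. a < d \<Longrightarrow> algebraic_int (y a)"
  shows "alg_cong m ((vandermonde d x)\<^sup>2) ((vandermonde d y)\<^sup>2)"
  unfolding vandermonde_def using assms
  by (intro alg_cong_power alg_cong_prod algebraic_int_prod algebraic_int_diff) auto

text \<open>The Frobenius congruence is applied to each difference of roots and multiplied over all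
  pairs.\<close>

lemma Delta_mult_prime_cong:
  assumes p: "p = 2 \<or> p = 3"
  shows "[Delta (n * p) = Delta n ^ p] (mod int p)"
proof -
  have "alg_cong (int p) ((vandermonde d (\<lambda>i. (\<alpha> i ^ n) ^ p))\<^sup>2)
      ((\<Prod>a<d. \<Prod>b<a. (\<alpha> a ^ n - \<alpha> b ^ n) ^ p)\<^sup>2)"
    unfolding vandermonde_def using algebraic_int_root
    by (intro alg_cong_power alg_cong_prod algebraic_int_prod algebraic_int_diff
          alg_cong_frobenius p algebraic_int_power) auto
  also have "(\<Prod>a<d. \<Prod>b<a. (\<alpha> a ^ n - \<alpha> b ^ n) ^ p)\<^sup>2 = of_int (Delta n ^ p)"
    by (simp add: of_int_D vandermonde_def prod_power_distrib power_mult[symmetric] mult.commute)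
  also have "(vandermonde d (\<lambda>i. (\<alpha> i ^ n) ^ p))\<^sup>2 = of_int (Delta (n * p))"
    by (simp add: of_int_D power_mult)
  finally show ?thesis
    by (rule alg_cong_imp_cong)
qed

lemma dvd_D_mult_prime_power:
  assumes p: "p = 2 \<or> p = 3" and "int p dvd Delta (n * p ^ k)"
  shows "int p dvd Delta n"
  using assms(2)
proof (induction k)
  case (Suc k)
  have "prime (int p)" using p by auto
  moreover have "int p dvd Delta (n * p ^ k) ^ p"
    using Suc.prems Delta_mult_prime_cong[OF p, of "n * p ^ k"]
    by (simp add: cong_dvd_iff mult_ac)
  ultimately have "int p dvd Delta (n * p ^ k)" by (rule prime_dvd_power)
  then show ?case by (rule Suc.IH)
qed simp

text \<open>The modulus 6 gives one period and one threshold for both primes 2 and 3.\<close>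

lemma Delta_periodic: "\<exists>N>0. \<exists>n0. \<forall>n\<ge>n0. \<forall>j. [Delta (n + N * j) = Delta n] (mod 6)"
proof -
  have "\<exists>N>0. \<exists>n0. \<forall>i\<in>{..<d}. \<forall>n\<ge>n0. alg_cong 6 (\<alpha> i ^ (n + N)) (\<alpha> i ^ n)"
    by (rule algebraic_int_powers_periodic) (use algebraic_int_root in auto)
  then obtain N n0 where N: "N > 0"
      "\<And>i n. i < d \<Longrightarrow> n \<ge> n0 \<Longrightarrow> alg_cong 6 (\<alpha> i ^ (n + N)) (\<alpha> i ^ n)"
    by blast
  have "[Delta (n + N * j) = Delta n] (mod 6)" if "n \<ge> n0" for n j
  proof -
    have "alg_cong 6 (\<alpha> i ^ (n + N * j)) (\<alpha> i ^ n)" if "i < d" for i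
      using alg_cong_power_iterate_period[of n0 6 "\<alpha> i" N n j] N(2) that \<open>n \<ge> n0\<close> by blast
    then have "alg_cong 6 (of_int (Delta (n + N * j)) :: complex) (of_int (Delta n))"
      unfolding of_int_D using algebraic_int_root
      by (intro alg_cong_vandermonde_square alg_cong_diff algebraic_int_power) auto
    then show ?thesis by (rule alg_cong_imp_cong)
  qed
  with N(1) show ?thesis by blast
qed

text \<open>Stickelberger's argument: \<open>T = \<Prod>j<k. (\<alpha>\<^sub>k\<^sup>n + \<alpha>\<^sub>j\<^sup>n)\<close> is the integer \<open>V(2 n)/V(n)\<close>, and
  \<open>(a - b)\<^sup>2\<close> differs from \<open>(a + b)\<^sup>2\<close> by \<open>4 a b\<close>, so the discriminant is \<open>T\<^sup>2\<close> modulo 4.\<close>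

lemma Delta_mod_4: "Delta n mod 4 = 0 \<or> Delta n mod 4 = 1"
proof (cases "vandermonde d (\<lambda>i. \<alpha> i ^ n) = 0")
  case True
  then have "(of_int (Delta n) :: complex) = of_int 0" unfolding of_int_D by simp
  then have "Delta n = 0" unfolding of_int_eq_iff .
  then show ?thesis by simp
next
  case False
  define T where "T = (\<Prod>a<d. \<Prod>b<a. \<alpha> a ^ n + \<alpha> b ^ n)"
  have T_alg: "algebraic_int T"
    unfolding T_def using algebraic_int_root
    by (intro algebraic_int_prod algebraic_int_add algebraic_int_power) auto
  have "vandermonde d (\<lambda>i. \<alpha> i ^ n) * T = vandermonde d (\<lambda>i. \<alpha> i ^ (2 * n))"
    unfolding vandermonde_def T_def prod.distrib[symmetric]
    by (intro prod.cong) (simp_all add: power_mult power2_eq_square algebra_simps power_mult_distrib)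
  moreover obtain s where s: "vandermonde d (\<lambda>i. \<alpha> i ^ n) = vandermonde d \<alpha> * of_int s"
    using vandermonde_power_multiple by blast
  moreover obtain s' where "vandermonde d (\<lambda>i. \<alpha> i ^ (2 * n)) = vandermonde d \<alpha> * of_int s'"
    using vandermonde_power_multiple by blast
  \<comment> \<open>Both Vandermonde determinants are integer multiples of the same number, nonzero
    here, which cancels in the quotient.\<close>
  ultimately have "T = of_int s' / of_int s"
    using False by (simp add: field_simps)
  then have "T \<in> \<rat>" by simp
  with T_alg have "T \<in> \<int>" by (rule rational_algebraic_int_is_int)
  then obtain t where t: "T = of_int t" by (rule Ints_cases)
  have "alg_cong 4 ((\<Prod>a<d. \<Prod>b<a. (\<alpha> a ^ n - \<alpha> b ^ n)\<^sup>2)) (\<Prod>a<d. \<Prod>b<a. (\<alpha> a ^ n + \<alpha> b ^ n)\<^sup>2)"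
  proof -
    have alg: "algebraic_int (\<alpha> a ^ n)" if "a < d" for a
      using algebraic_int_root that by (intro algebraic_int_power)
    have "alg_cong 4 ((\<alpha> a ^ n - \<alpha> b ^ n)\<^sup>2) ((\<alpha> a ^ n + \<alpha> b ^ n)\<^sup>2)" if "b < a" "a < d" for a b
      unfolding alg_cong_def using alg[of a] alg[of b] that
      by (intro exI[of _ "- (\<alpha> a ^ n * \<alpha> b ^ n)"])
        (simp_all add: power2_eq_square algebra_simps algebraic_int_mult)
    moreover have "algebraic_int ((\<alpha> a ^ n + \<alpha> b ^ n)\<^sup>2)" if "b < a" "a < d" for a b
      using alg[of a] alg[of b] that by (auto intro: algebraic_int_power[OF algebraic_int_add])
    ultimately show ?thesis
      by (intro alg_cong_prod algebraic_int_prod) auto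
  qed
  also have "(\<Prod>a<d. \<Prod>b<a. (\<alpha> a ^ n - \<alpha> b ^ n)\<^sup>2) = of_int (Delta n)"
    by (simp add: of_int_D vandermonde_def prod_power_distrib)
  also have "(\<Prod>a<d. \<Prod>b<a. (\<alpha> a ^ n + \<alpha> b ^ n)\<^sup>2) = of_int (t\<^sup>2)"
    by (simp add: t[symmetric] T_def prod_power_distrib)
  finally have "[Delta n = t\<^sup>2] (mod 4)"
    by (rule alg_cong_imp_cong)
  moreover have "t\<^sup>2 mod 4 = 0 \<or> t\<^sup>2 mod 4 = 1"
  proof (cases "even t")
    case True
    then obtain u where "t = 2 * u" by (rule evenE)
    then show ?thesis by (simp add: power_mult_distrib)
  next
    case False
    then obtain u where "t = 2 * u + 1" by (rule oddE)
    then have "t\<^sup>2 = 1 + 4 * (u\<^sup>2 + u)" by (simp add: power2_eq_square algebra_simps)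
    then obtain w where "t\<^sup>2 = 1 + 4 * w" by blast
    then show ?thesis by presburger
  qed
  ultimately show ?thesis by (simp add: cong_def)
qed

text \<open>\<open>Delta n\<close> is \<open>Delta 1\<close> times a square, and a square prime to 3
  is 1 modulo 3.\<close>

lemma Delta_mod_3:
  assumes "\<not> 3 dvd Delta n"
  shows "[Delta n = Delta 1] (mod 3)"
proof -
  obtain s where s: "Delta n = Delta 1 * s\<^sup>2" using Delta_eq_square_mult by blast
  have "\<not> 3 dvd s"
    using assms s by (auto simp: power2_eq_square)
  then have "s mod 3 = 1 \<or> s mod 3 = 2" by presburger
  moreover have "s\<^sup>2 mod 3 = (s mod 3)\<^sup>2 mod 3"
    by (simp add: power_mod)
  ultimately have "[s\<^sup>2 = 1] (mod 3)"
    by (auto simp: cong_def)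
  then have "[Delta 1 * s\<^sup>2 = Delta 1 * 1] (mod 3)"
    by (rule cong_scalar_left)
  then show ?thesis by (simp add: s)
qed

lemma Delta_gcd_cong: "\<exists>N>0. \<forall>n>0. [Delta n = Delta (gcd n N)] (mod 12)"
proof -
  obtain N n0 where N: "N > 0" and per: "\<And>n j. n \<ge> n0 \<Longrightarrow> [Delta (n + N * j) = Delta n] (mod 6)"
    using Delta_periodic by metis
  have "[Delta n = Delta (gcd n N)] (mod 12)" if n: "n > 0" for n
  proof -
    define g where "g = gcd n N"
    have g: "g > 0" using n by (simp add: g_def)
    \<comment> \<open>Bezout: some multiple of \<open>n\<close> is congruent to \<open>g\<close>
      modulo the period \<open>N\<close>.\<close>
    obtain v t where vt: "n * v = N * t + g"
      using bezout_nat[of n N] n unfolding g_def by blast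
    have dvd_iff: "int p dvd Delta n \<longleftrightarrow> int p dvd Delta g" if p: "p = 2 \<or> p = 3" for p
    proof
      assume "int p dvd Delta g"
      then have "int p dvd Delta (g * (n div g))" by (rule dvd_D_mult)
      then show "int p dvd Delta n" by (simp add: g_def)
    next
      assume "int p dvd Delta n"
      \<comment> \<open>The factor \<open>p ^ n0\<close> pushes the index past the threshold
        \<open>n0\<close>, so that periodicity removes the multiple of \<open>N\<close>; the
        Frobenius descent then removes \<open>p ^ n0\<close> again.\<close>
      then have "int p dvd Delta (n * (v * p ^ n0))" by (rule dvd_D_mult)
      also have "n * (v * p ^ n0) = g * p ^ n0 + N * (t * p ^ n0)"
        unfolding mult.assoc[symmetric] vt by (simp add: algebra_simps)
      finally have *: "int p dvd Delta (g * p ^ n0 + N * (t * p ^ n0))" .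
      have "n0 < p ^ n0" using p by (intro power_gt_expt) auto
      also have "1 * p ^ n0 \<le> g * p ^ n0" using g by (intro mult_le_mono1) simp
      then have "p ^ n0 \<le> g * p ^ n0" by simp
      finally have "n0 \<le> g * p ^ n0" by simp
      then have "[Delta (g * p ^ n0 + N * (t * p ^ n0)) = Delta (g * p ^ n0)] (mod 6)"
        by (rule per)
      then have "[Delta (g * p ^ n0 + N * (t * p ^ n0)) = Delta (g * p ^ n0)] (mod int p)"
        by (rule cong_dvd_modulus) (use p in auto)
      with * have "int p dvd Delta (g * p ^ n0)" by (simp add: cong_dvd_iff)
      with p show "int p dvd Delta g" by (rule dvd_D_mult_prime_power)
    qed
    have "[Delta n = Delta g] (mod 3)"
    proof (cases "3 dvd Delta n")
      case True
      then have "3 dvd Delta g" using dvd_iff[of 3] by simp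
      with True show ?thesis by (simp add: cong_def)
    next
      case False
      then have "\<not> 3 dvd Delta g" using dvd_iff[of 3] by simp
      with False show ?thesis
        by (intro cong_trans[OF Delta_mod_3 cong_sym[OF Delta_mod_3]])
    qed
    moreover have "[Delta n = Delta g] (mod 4)"
    proof -
      \<comment> \<open>Since only the residues 0 and 1 modulo 4 occur, parity determines the
        residue.\<close>
      have parity: "even (Delta n) \<longleftrightarrow> even (Delta g)" using dvd_iff[of 2] by simp
      have mod_4_eq: "a mod 4 = b mod 4"
        if "even a \<longleftrightarrow> even b" "a mod 4 = 0 \<or> a mod 4 = 1" "b mod 4 = 0 \<or> b mod 4 = 1" for a b :: int
        using that by presburger
      show ?thesis
        unfolding cong_def by (rule mod_4_eq[OF parity Delta_mod_4 Delta_mod_4])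
    qed
    moreover have "coprime (3 :: int) 4"
      using coprime_add_one_right[of "3 :: int"] by simp
    ultimately have "[Delta n = Delta g] (mod 3 * 4)"
      by (rule coprime_cong_mult)
    then show ?thesis by (simp add: g_def)
  qed
  with N show ?thesis by blast
qed

end

section \<open>Passage to the multiset of complex roots and conclusion\<close>

lemma monic_roots_exists:
  assumes "lead_coeff P = 1"
  obtains \<alpha> where "mset \<alpha> = proots (map_poly of_int P)"
    "monic_roots P (length \<alpha>) ((!) \<alpha>)"
proof -
  let ?P = "map_poly of_int P :: complex poly"
  obtain \<alpha> where \<alpha>: "mset \<alpha> = proots ?P" using ex_mset by blast
  have "lead_coeff ?P = 1" using assms by simp
  then have "?P = (\<Prod>x\<in>#proots ?P. [:- x, 1:])"
    using complex_poly_decompose_multiset[of ?P] by (metis smult_1_left)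
  also have "\<dots> = (\<Prod>i<length \<alpha>. [:- (\<alpha> ! i), 1:])"
    by (simp only: \<alpha>[symmetric] mset_map[symmetric] prod_mset_prod_list)
      (simp add: prod.list_conv_set_nth atLeast0LessThan)
  finally have "monic_roots P (length \<alpha>) ((!) \<alpha>)"
    using assms by unfold_locales
  with \<alpha> that show ?thesis by blast
qed

theorem theorem8p14:
  fixes P :: "int poly"
  assumes "lead_coeff P = 1"
  shows "finite {n. n > 0 \<and> \<not> (\<exists>k::int. delta n P = of_int k \<and> 12 dvd k)}"
proof -
  obtain \<alpha> where \<alpha>: "mset \<alpha> = proots (map_poly of_int P)" "monic_roots P (length \<alpha>) ((!) \<alpha>)"
    using monic_roots_exists[OF assms] by blast
  interpret monic_roots P "length \<alpha>" "(!) \<alpha>" by (rule \<alpha>(2))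
  obtain N where N: "N > 0" "\<And>n. n > 0 \<Longrightarrow> [Delta n = Delta (gcd n N)] (mod 12)"
    using Delta_gcd_cong by blast
  \<comment> \<open>The differences are taken in opposite orders on the two sides; squaring removes
    the sign.\<close>
  have "discriminant (power_poly P n) = of_int (Delta n)" for n
    unfolding discriminant_power_poly[OF \<alpha>(1)] of_int_D vandermonde_def
    by (simp add: prod_power_distrib power2_commute)
  then have delta: "delta n P = of_int (\<Sum>m | m dvd n. moebius (n div m) * Delta m)" for n
    by (simp add: delta_def)
  have "12 dvd (\<Sum>m | m dvd n. moebius (n div m) * Delta m)" if "n > 0" "\<not> n dvd N" for n
    by (rule dvd_moebius_sum_gcd[of Delta N]) (use N that in auto)
  \<comment> \<open>Every exceptional \<open>n\<close> divides the fixed positive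
    \<open>N\<close>.\<close>
  then have "{n. n > 0 \<and> \<not> (\<exists>k::int. delta n P = of_int k \<and> 12 dvd k)} \<subseteq> {n. n dvd N}"
    unfolding delta by blast
  then show ?thesis
    by (rule finite_subset) (use N(1) in simp)
qed

end
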